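(* For positive integers $n,d$, let $C(n,d)$ denote the maximum attainable number of orthant interiors of $\mathbb{R}^n$ intersected by a subspace of $\mathbb{R}^n$ generated by $d$ vectors. Then $C(n,1)=2$ for all $n\ge1$, and $C(n,d)=2^n$ for all $d\ge n$. In general, $$C(n,d)=2\sum_{i=0}^{d-1}\binom{n-1}{i}\quad\text{for all } n,d\ge1,$$ and $C(n,d)=C(n-1,d-1)+C(n-1,d)$ for all $n,d\ge2$.
   Context: The subspace generated by $d$ vectors $v_1,\dots,v_d\in\mathbb{R}^n$ (called a "hyperplane" in the source) is their linear span. The orthant interiors of $\mathbb{R}^n$ are the $2^n$ open sets $\{x\in\mathbb{R}^n\mid \mathrm{sign}(x_i)=\epsilon_i,\ i=1,\dots,n\}$ with $\epsilon\in\{-1,1\}^n$. Thus $C(n,d)$ is the maximum, over all $v_1,\dots,v_d\in\mathbb{R}^n$, of the number of $\epsilon\in\{-1,1\}^n$ such that some $x\in\mathrm{span}\{v_1,\dots,v_d\}$ satisfies $\mathrm{sign}(x_i)=\epsilon_i$ for all $i$. Binomial coefficients $\binom{a}{i}$ with $i>a$ are zero. *)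

theory Defs
  imports "Jordan_Normal_Form.VS_Connect"
begin

text \<open>Vectors of dimension n are elements of \<^term>\<open>carrier_vec n\<close>, so that n can be an ordinary
  natural number and dimensions n and n - 1 can be compared in one statement.\<close>

definition subspace_gen :: "nat \<Rightarrow> real vec list \<Rightarrow> real vec set" where
  "subspace_gen n vs = LinearCombinations.module.span class_ring (module_vec TYPE(real) n) (set vs)"

definition sign_vectors :: "nat \<Rightarrow> real vec set" where
  "sign_vectors n = {e \<in> carrier_vec n. \<forall>i<n. e $ i \<in> {-1, 1}}"

definition orthant_interior :: "nat \<Rightarrow> real vec \<Rightarrow> real vec set" where
  "orthant_interior n e = {x \<in> carrier_vec n. \<forall>i<n. sgn (x $ i) = e $ i}"

definition num_orthants :: "nat \<Rightarrow> real vec set \<Rightarrow> nat" where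
  "num_orthants n S = card {e \<in> sign_vectors n. S \<inter> orthant_interior n e \<noteq> {}}"

text \<open>The generators form a list of length d: they may be linearly dependent and may repeat.\<close>

definition max_orthants :: "nat \<Rightarrow> nat \<Rightarrow> nat" where
  "max_orthants n d =
     Max {num_orthants n (subspace_gen n vs) | vs. length vs = d \<and> set vs \<subseteq> carrier_vec n}"

text \<open>\<^const>\<open>Max\<close> is only meaningful on finite nonempty sets; this is the case here.\<close>

lemma finite_sign_vectors: "finite (sign_vectors n)"
proof (rule finite_subset)
  show "sign_vectors n \<subseteq> vec_of_list ` {xs. set xs \<subseteq> {-1, 1} \<and> length xs = n}"
  proof
    fix e assume e: "e \<in> sign_vectors n"
    have "set (list_of_vec e) \<subseteq> {-1, 1}"
      using e by (auto simp: sign_vectors_def set_conv_nth list_of_vec_index)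
    moreover have "length (list_of_vec e) = n" using e by (auto simp: sign_vectors_def)
    moreover have "e = vec_of_list (list_of_vec e)" by (simp add: vec_list)
    ultimately show "e \<in> vec_of_list ` {xs. set xs \<subseteq> {-1, 1} \<and> length xs = n}" by blast
  qed
qed (intro finite_imageI finite_lists_length_eq, simp)

lemma finite_num_orthants:
  "finite {num_orthants n (subspace_gen n vs) | vs. length vs = d \<and> set vs \<subseteq> carrier_vec n}"
proof (rule finite_subset)
  show "{num_orthants n (subspace_gen n vs) | vs. length vs = d \<and> set vs \<subseteq> carrier_vec n}
      \<subseteq> {..card (sign_vectors n)}"
    by (auto simp: num_orthants_def intro!: card_mono finite_sign_vectors)
qed simp

lemma nonempty_num_orthants:
  "{num_orthants n (subspace_gen n vs) | vs. length vs = d \<and> set vs \<subseteq> carrier_vec n} \<noteq> {}"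
proof -
  have "length (replicate d (0\<^sub>v n :: real vec)) = d \<and> set (replicate d (0\<^sub>v n :: real vec)) \<subseteq> carrier_vec n"
    by auto
  then show ?thesis by blast
qed

end

theory Submission
  imports Defs
begin

text \<open>Upper bound: identify a sign pattern with its set of positive coordinates. Any d + 1
  coordinates satisfy a nontrivial linear relation on a subspace with d generators, so some sign
  pattern on them is excluded and no set of d + 1 coordinates is shattered. The family of patterns
  is closed under complement; fixing the sign of the last coordinate halves it and lowers the size
  of shattered sets to d - 1, so the Sauer-Shelah inequality on n - 1 points gives the bound.
  Lower bound: polynomials of degree less than d, evaluated at n points, realise every pattern
  with at most d - 1 sign changes.\<close>

section \<open>Shattering\<close>

definition shatters :: "'a set set \<Rightarrow> 'a set \<Rightarrow> bool" where
  "shatters F S \<longleftrightarrow> (\<forall>T\<subseteq>S. \<exists>A\<in>F. A \<inter> S = T)"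

lemma shatters_mono: "shatters F S \<Longrightarrow> F \<subseteq> G \<Longrightarrow> shatters G S"
  unfolding shatters_def by (meson subsetD)

text \<open>Pajor's form of the Sauer-Shelah inequality: counting shattered sets instead of bounding
  their size lets the induction on \<open>X\<close> go through. Splitting \<open>F\<close> at
  \<open>x\<close> gives two families on \<open>X\<close>, and a set shattered by both stays
  shattered by \<open>F\<close> when \<open>x\<close> is added.\<close>

lemma card_le_card_shattered:
  assumes "finite X" "F \<subseteq> Pow X"
  shows "card F \<le> card {S. S \<subseteq> X \<and> shatters F S}"
  using assms
proof (induction X arbitrary: F rule: finite_induct)
  case empty
  then consider "F = {}" | "F = {{}}" by auto
  then show ?case
  proof cases
    case 2
    then have "{S. S \<subseteq> {} \<and> shatters F S} = {{}}" by (auto simp: shatters_def)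
    with 2 show ?thesis by simp
  qed simp
next
  case (insert x X)
  define F0 F1 where "F0 = {A \<in> F. x \<notin> A}" and "F1 = (\<lambda>A. A - {x}) ` {A \<in> F. x \<in> A}"
  define Sh where "Sh = (\<lambda>G. {S. S \<subseteq> X \<and> shatters G S})"
  have fin: "finite F" using insert by (meson finite_Pow_iff finite_insert finite_subset)
  have sub: "F0 \<subseteq> Pow X" "F1 \<subseteq> Pow X" using insert.prems by (auto simp: F0_def F1_def)
  have finSh: "finite (Sh G)" for G unfolding Sh_def using insert.hyps by auto
  have "inj_on (\<lambda>A. A - {x}) {A \<in> F. x \<in> A}" by (rule inj_onI) blast
  then have "card F1 = card {A \<in> F. x \<in> A}" unfolding F1_def by (rule card_image)
  moreover have "card F = card {A \<in> F. x \<in> A} + card F0"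
  proof -
    have "F = {A \<in> F. x \<in> A} \<union> F0" by (auto simp: F0_def)
    moreover have "card ({A \<in> F. x \<in> A} \<union> F0) = card {A \<in> F. x \<in> A} + card F0"
      using fin by (intro card_Un_disjoint) (auto simp: F0_def)
    ultimately show ?thesis by simp
  qed
  ultimately have "card F = card F0 + card F1" by simp
  also have "\<dots> \<le> card (Sh F0) + card (Sh F1)"
    unfolding Sh_def by (intro add_mono insert.IH sub)
  \<comment> \<open>A set shattered by both halves is counted twice; its second copy is traded for
    its extension by \<open>x\<close>, which is a new set because it is not contained in
    \<open>X\<close>.\<close>
  also have "\<dots> = card (Sh F0 \<union> Sh F1) + card (insert x ` (Sh F0 \<inter> Sh F1))"
  proof -
    have "inj_on (insert x) (Sh F0 \<inter> Sh F1)"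
      using insert.hyps by (auto simp: Sh_def inj_on_def)
    then show ?thesis using card_Un_Int[OF finSh finSh] by (simp add: card_image)
  qed
  also have "\<dots> = card ((Sh F0 \<union> Sh F1) \<union> insert x ` (Sh F0 \<inter> Sh F1))"
    using finSh insert.hyps by (subst card_Un_disjoint) (auto simp: Sh_def)
  also have "\<dots> \<le> card {S. S \<subseteq> insert x X \<and> shatters F S}"
  proof (rule card_mono)
    have "shatters F S" if "S \<in> Sh F0" for S
      using that shatters_mono[of F0 S F] by (auto simp: Sh_def F0_def)
    moreover have "shatters F S" if S: "S \<in> Sh F1" for S
      unfolding shatters_def
    proof (intro allI impI)
      fix T assume "T \<subseteq> S"
      with S obtain A where "A \<in> F" "(A - {x}) \<inter> S = T"
        unfolding Sh_def shatters_def F1_def by blast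
      moreover have "x \<notin> S" using S insert.hyps by (auto simp: Sh_def)
      ultimately show "\<exists>A\<in>F. A \<inter> S = T" by blast
    qed
    moreover have "shatters F (insert x S)" if S: "S \<in> Sh F0" "S \<in> Sh F1" for S
      unfolding shatters_def
    proof (intro allI impI)
      fix T assume T: "T \<subseteq> insert x S"
      then have T': "T - {x} \<subseteq> S" by blast
      have x: "x \<notin> S" using S insert.hyps by (auto simp: Sh_def)
      show "\<exists>A\<in>F. A \<inter> insert x S = T"
      proof (cases "x \<in> T")
        case True
        from S(2) T' obtain A where "A \<in> F" "x \<in> A" "(A - {x}) \<inter> S = T - {x}"
          unfolding Sh_def shatters_def F1_def by blast
        with True x show ?thesis by blast
      next
        case False
        from S(1) T' obtain A where "A \<in> F" "x \<notin> A" "A \<inter> S = T - {x}"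
          unfolding Sh_def shatters_def F0_def by blast
        with False x show ?thesis by blast
      qed
    qed
    ultimately show "Sh F0 \<union> Sh F1 \<union> insert x ` (Sh F0 \<inter> Sh F1) \<subseteq> {S. S \<subseteq> insert x X \<and> shatters F S}"
      by (auto simp: Sh_def)
  qed (use insert.hyps in auto)
  finally show ?case .
qed

lemma card_subsets_le:
  "card {S. S \<subseteq> {..<m::nat} \<and> card S \<le> k} = (\<Sum>i = 0..k. m choose i)"
proof -
  have "{S. S \<subseteq> {..<m} \<and> card S \<le> k} = (\<Union>i\<in>{0..k}. {S. S \<subseteq> {..<m} \<and> card S = i})" by auto
  also have "card \<dots> = (\<Sum>i = 0..k. card {S. S \<subseteq> {..<m} \<and> card S = i})"
    by (rule card_UN_disjoint) auto
  also have "\<dots> = (\<Sum>i = 0..k. m choose i)" by (simp add: n_subsets)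
  finally show ?thesis .
qed

text \<open>Complementation pairs the members of F that contain m with those that do not. A set
  S shattered by the latter gives a set \<open>insert m S\<close> shattered by F, which is why the
  Sauer-Shelah bound is applied on m points with the size bound decreased by one.\<close>

lemma card_complement_closed_le:
  fixes F :: "nat set set"
  assumes F: "F \<subseteq> Pow {..<Suc m}"
    and compl: "\<And>A. A \<in> F \<Longrightarrow> {..<Suc m} - A \<in> F"
    and shat: "\<And>S. S \<subseteq> {..<Suc m} \<Longrightarrow> shatters F S \<Longrightarrow> card S \<le> Suc k"
  shows "card F \<le> 2 * (\<Sum>i = 0..k. m choose i)"
proof -
  define B where "B = {A \<in> F. m \<notin> A}"
  have B: "B \<subseteq> Pow {..<m}" using F by (auto simp: B_def lessThan_Suc)
  have fin: "finite F" using F by (meson finite_Pow_iff finite_lessThan finite_subset)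
  have "F \<subseteq> B \<union> (\<lambda>A. {..<Suc m} - A) ` B"
  proof
    fix A assume A: "A \<in> F"
    have "A = {..<Suc m} - ({..<Suc m} - A)" using A F by auto
    moreover have "{..<Suc m} - A \<in> B" if "m \<in> A" using that compl[OF A] by (simp add: B_def)
    ultimately show "A \<in> B \<union> (\<lambda>A. {..<Suc m} - A) ` B" using A by (auto simp: B_def)
  qed
  then have "card F \<le> card (B \<union> (\<lambda>A. {..<Suc m} - A) ` B)"
    using fin by (intro card_mono) (auto simp: B_def)
  also have "\<dots> \<le> card B + card ((\<lambda>A. {..<Suc m} - A) ` B)" by (rule card_Un_le)
  also have "\<dots> \<le> 2 * card B" using card_image_le[of B "\<lambda>A. {..<Suc m} - A"] fin by (simp add: B_def)
  also have "card B \<le> card {S. S \<subseteq> {..<m} \<and> shatters B S}"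
    using B by (intro card_le_card_shattered) auto
  also have "\<dots> \<le> card {S. S \<subseteq> {..<m} \<and> card S \<le> k}"
  proof (rule card_mono)
    show "{S. S \<subseteq> {..<m} \<and> shatters B S} \<subseteq> {S. S \<subseteq> {..<m} \<and> card S \<le> k}"
    proof clarify
      fix S assume S: "S \<subseteq> {..<m}" "shatters B S"
      have "shatters F (insert m S)"
        unfolding shatters_def
      proof (intro allI impI)
        fix T assume T: "T \<subseteq> insert m S"
        show "\<exists>A\<in>F. A \<inter> insert m S = T"
        proof (cases "m \<in> T")
          case False
          with T S(2) obtain A where "A \<in> B" "A \<inter> S = T" unfolding shatters_def by blast
          with False show ?thesis by (auto simp: B_def)
        next
          case True
          \<comment> \<open>A member of \<open>B\<close> with the opposite trace
            \<open>S - T\<close> also misses \<open>m\<close>, so its complement contains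
            \<open>m\<close> and has trace \<open>T\<close> on \<open>insert m S\<close>.\<close>
          have "S - T \<subseteq> S" by blast
          with S(2) obtain A where A: "A \<in> B" "A \<inter> S = S - T" unfolding shatters_def by blast
          then have "({..<Suc m} - A) \<inter> insert m S = T" using True T S(1) by (auto simp: B_def)
          moreover have "{..<Suc m} - A \<in> F" using A(1) by (intro compl) (simp add: B_def)
          ultimately show ?thesis by blast
        qed
      qed
      moreover have "insert m S \<subseteq> {..<Suc m}" using S by auto
      ultimately have "card (insert m S) \<le> Suc k" by (intro shat)
      moreover have "finite S" "m \<notin> S" using S finite_subset by auto
      ultimately show "card S \<le> k" by simp
    qed
  qed auto
  also have "\<dots> = (\<Sum>i = 0..k. m choose i)" by (rule card_subsets_le)
  finally show ?thesis by simp
qed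

section \<open>Sign patterns of a finitely generated subspace\<close>

text \<open>These are \<open>d\<close> homogeneous linear equations in more than \<open>d\<close>
  unknowns. Padding the coefficient matrix with zero rows makes it square and singular, and a
  nonzero kernel vector is the relation.\<close>

lemma ex_nontrivial_relation:
  fixes f :: "nat \<Rightarrow> 'a \<Rightarrow> 'b::field"
  assumes J: "finite J" "d < card J"
  shows "\<exists>c. (\<exists>j\<in>J. c j \<noteq> 0) \<and> (\<forall>i<d. (\<Sum>j\<in>J. c j * f i j) = 0)"
proof -
  define m where "m = card J"
  obtain b where b: "bij_betw b {0..<m} J"
    using ex_bij_betw_nat_finite[OF J(1)] unfolding m_def by blast
  define r where "r = (\<lambda>i. if i < d then vec m (\<lambda>k. f i (b k)) else 0\<^sub>v m)"
  \<comment> \<open>Row \<open>d\<close> exists because \<open>d < m\<close>. It is already zero in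
    \<open>r\<close>; naming it separately gives the shape that \<open>det_row_0\<close>
    expects.\<close>
  define M where "M = mat\<^sub>r m m (\<lambda>i. if i = d then 0\<^sub>v m else r i)"
  have "det M = 0" unfolding M_def using J(2) by (intro det_row_0) (auto simp: m_def r_def)
  moreover have M: "M \<in> carrier_mat m m" by (simp add: M_def)
  ultimately obtain v where v: "v \<in> carrier_vec m" "v \<noteq> 0\<^sub>v m" "M *\<^sub>v v = 0\<^sub>v m"
    using det_0_iff_vec_prod_zero[OF M] by auto
  define c where "c = (\<lambda>j. v $ inv_into {0..<m} b j)"
  have cb: "c (b k) = v $ k" if "k < m" for k
    using that b by (simp add: c_def bij_betw_def inv_into_f_f)
  obtain k where k: "k < m" "v $ k \<noteq> 0" using v(1,2) by (metis carrier_vecD eq_vecI index_zero_vec)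
  have "\<exists>j\<in>J. c j \<noteq> 0"
    using k cb[of k] b by (intro bexI[of _ "b k"]) (auto simp: bij_betw_def)
  moreover have "(\<Sum>j\<in>J. c j * f i j) = 0" if i: "i < d" for i
  proof -
    have im: "i < m" using i J(2) by (simp add: m_def)
    have "(\<Sum>j\<in>J. c j * f i j) = (\<Sum>k=0..<m. c (b k) * f i (b k))"
      by (rule sum.reindex_bij_betw[OF b, symmetric])
    also have "\<dots> = (M *\<^sub>v v) $ i"
      using i im v(1) by (auto simp: M_def r_def scalar_prod_def cb mult.commute intro!: sum.cong)
    also have "\<dots> = 0" using v(3) im by simp
    finally show ?thesis .
  qed
  ultimately show ?thesis by blast
qed

text \<open>The excluded pattern is read off a linear relation \<open>c\<close>: if each value had
  the sign of its coefficient, all terms of the relation would be nonnegative and one positive, so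
  they could not sum to zero.\<close>

lemma not_all_sign_patterns:
  fixes f :: "nat \<Rightarrow> 'a \<Rightarrow> real"
  assumes J: "finite J" "d < card J"
  shows "\<exists>T\<subseteq>J. \<forall>a. \<not> (\<forall>j\<in>J. (\<Sum>i<d. a i * f i j) \<noteq> 0 \<and> ((\<Sum>i<d. a i * f i j) > 0 \<longleftrightarrow> j \<in> T))"
proof -
  obtain c j0 where c: "j0 \<in> J" "c j0 \<noteq> 0" "\<forall>i<d. (\<Sum>j\<in>J. c j * f i j) = 0"
    using ex_nontrivial_relation[OF J] by blast
  have "\<not> (\<forall>j\<in>J. (\<Sum>i<d. a i * f i j) \<noteq> 0 \<and> ((\<Sum>i<d. a i * f i j) > 0 \<longleftrightarrow> j \<in> {j\<in>J. c j > 0}))" for a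
  proof
    let ?x = "\<lambda>j. \<Sum>i<d. a i * f i j"
    assume a: "\<forall>j\<in>J. ?x j \<noteq> 0 \<and> (?x j > 0 \<longleftrightarrow> j \<in> {j\<in>J. c j > 0})"
    \<comment> \<open>Exchanging the sums shows that the relation, known for the generators, holds
      for every combination of them.\<close>
    have "(\<Sum>j\<in>J. c j * ?x j) = (\<Sum>i<d. \<Sum>j\<in>J. c j * (a i * f i j))"
      by (simp add: sum_distrib_left sum.swap[of _ J])
    also have "\<dots> = (\<Sum>i<d. a i * (\<Sum>j\<in>J. c j * f i j))"
      by (simp add: sum_distrib_left mult_ac)
    also have "\<dots> = 0" using c(3) by simp
    finally have "(\<Sum>j\<in>J. c j * ?x j) = 0" .
    moreover have "(\<Sum>j\<in>J. c j * ?x j) > 0"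
    proof (rule sum_pos2[OF J(1) c(1)])
      have neg: "?x j < 0" if "j \<in> J" "c j \<le> 0" for j
      proof -
        have "?x j \<noteq> 0" "\<not> ?x j > 0" using a that by auto
        then show ?thesis by linarith
      qed
      then show "0 \<le> c j * ?x j" if "j \<in> J" for j
      proof (cases "c j > 0")
        case True
        then have "?x j > 0" using a that by blast
        with True show ?thesis by (intro mult_nonneg_nonneg less_imp_le)
      next
        case False
        then have nonpos: "c j \<le> 0" by simp
        show ?thesis by (rule mult_nonpos_nonpos[OF nonpos less_imp_le[OF neg[OF that nonpos]]])
      qed
      show "0 < c j0 * ?x j0"
      proof (cases "c j0 > 0")
        case True
        then have "?x j0 > 0" using a c(1) by blast
        with True show ?thesis by (rule mult_pos_pos)
      next
        case False
        with c(2) have "c j0 < 0" by simp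
        with neg[OF c(1)] show ?thesis by (intro mult_neg_neg) auto
      qed
    qed
    ultimately show False by simp
  qed
  then show ?thesis by (intro exI[of _ "{j\<in>J. c j > 0}"]) auto
qed

text \<open>Coefficients are attached to list positions rather than to vectors, so repeated
  generators need no special treatment. This goes through \<open>span_list\<close>, which agrees
  with the span of the underlying set.\<close>

lemma subspace_gen_iff:
  assumes "set vs \<subseteq> carrier_vec n"
  shows "x \<in> subspace_gen n vs \<longleftrightarrow> (\<exists>a. x = vec n (\<lambda>i. \<Sum>j<length vs. a j * vs ! j $ i))"
proof -
  interpret vec_space "TYPE(real)" n .
  have dim: "\<forall>w\<in>set vs. dim_vec w = n" using assms by auto
  have "lincomb_list c vs = vec n (\<lambda>i. \<Sum>j<length vs. c j * vs ! j $ i)" for c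
    unfolding lincomb_list_as_mat_mult[OF dim]
    by (rule eq_vecI) (auto simp: scalar_prod_def mat_of_cols_def atLeast0LessThan mult.commute intro!: sum.cong)
  moreover have "subspace_gen n vs = span_list vs"
    unfolding subspace_gen_def using span_list_as_span[OF assms] by simp
  ultimately show ?thesis by (auto simp: span_list_def)
qed

text \<open>Sign vectors become sets of positive coordinates. Negating the coefficients complements
  such a set, and the excluded pattern on any \<open>k + 2\<close> coordinates bounds the shattered
  sets, so \<open>card_complement_closed_le\<close> applies.\<close>

lemma num_orthants_le:
  assumes vs: "set vs \<subseteq> carrier_vec (Suc m)" "length vs = Suc k"
  shows "num_orthants (Suc m) (subspace_gen (Suc m) vs) \<le> 2 * (\<Sum>i = 0..k. m choose i)"
proof -
  define x where "x = (\<lambda>a i. \<Sum>j<Suc k. a j * vs ! j $ i)"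
  \<comment> \<open>Vanishing coordinates must be ruled out: they are positive neither for
    \<open>a\<close> nor for its negative, which would break closure under complement.\<close>
  define P where "P = {a. \<forall>i<Suc m. x a i \<noteq> 0}"
  define pos where "pos = (\<lambda>a. {i. i < Suc m \<and> x a i > 0})"
  define E where "E = {e \<in> sign_vectors (Suc m).
    subspace_gen (Suc m) vs \<inter> orthant_interior (Suc m) e \<noteq> {}}"
  \<comment> \<open>All entries are 1 or -1, so the positions of the ones determine the
    vector.\<close>
  let ?supp = "\<lambda>e :: real vec. {i. i < Suc m \<and> e $ i = 1}"
  have inj: "inj_on ?supp E"
  proof (rule inj_onI)
    fix e e' assume e: "e \<in> E" "e' \<in> E" "?supp e = ?supp e'"
    have "e $ i = e' $ i" if i: "i < Suc m" for i
    proof -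
      have "e $ i = 1 \<longleftrightarrow> e' $ i = 1" using e(3) i by blast
      moreover have "e $ i \<in> {-1, 1}" "e' $ i \<in> {-1, 1}"
        using e(1,2) i by (auto simp: E_def sign_vectors_def)
      ultimately show ?thesis by auto
    qed
    then show "e = e'" using e(1,2) by (intro eq_vecI) (auto simp: E_def sign_vectors_def)
  qed
  have sub: "?supp ` E \<subseteq> pos ` P"
  proof (rule image_subsetI)
    fix e assume e: "e \<in> E"
    then obtain y where y: "y \<in> subspace_gen (Suc m) vs" "\<forall>i<Suc m. sgn (y $ i) = e $ i"
      by (auto simp: E_def orthant_interior_def)
    then obtain a where "y = vec (Suc m) (x a)"
      using subspace_gen_iff[OF vs(1)] vs(2) by (auto simp: x_def)
    with y have a: "sgn (x a i) = e $ i" if "i < Suc m" for i using that by auto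
    have nz: "e $ i \<noteq> 0" if "i < Suc m" for i
      using e that by (force simp: E_def sign_vectors_def)
    have "a \<in> P" using a nz by (force simp: P_def)
    moreover have "?supp e = pos a" using a by (auto simp: pos_def sgn_1_pos[symmetric])
    ultimately show "?supp e \<in> pos ` P" by blast
  qed
  have fin: "finite (pos ` P)"
    by (rule finite_subset[of _ "Pow {..<Suc m}"]) (auto simp: pos_def)
  have "num_orthants (Suc m) (subspace_gen (Suc m) vs) = card (?supp ` E)"
    using card_image[OF inj] by (simp add: num_orthants_def E_def)
  also have "\<dots> \<le> card (pos ` P)" by (rule card_mono[OF fin sub])
  also have "\<dots> \<le> 2 * (\<Sum>i = 0..k. m choose i)"
  proof (rule card_complement_closed_le)
    show "pos ` P \<subseteq> Pow {..<Suc m}" by (auto simp: pos_def)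
  next
    fix A assume "A \<in> pos ` P"
    then obtain a where a: "a \<in> P" "A = pos a" by blast
    have neg: "x (\<lambda>j. - a j) i = - x a i" for i by (simp add: x_def sum_negf)
    have "{..<Suc m} - A = pos (\<lambda>j. - a j)"
      using a by (auto simp: pos_def neg P_def not_less order_le_less)
    moreover have "(\<lambda>j. - a j) \<in> P" using a(1) by (simp add: P_def neg)
    ultimately show "{..<Suc m} - A \<in> pos ` P" by blast
  next
    fix S assume S: "S \<subseteq> {..<Suc m}" "shatters (pos ` P) S"
    show "card S \<le> Suc k"
    proof (rule ccontr)
      assume "\<not> card S \<le> Suc k"
      then have "Suc k < card S" by simp
      from not_all_sign_patterns[OF finite_subset[OF S(1)] this, of "\<lambda>j i. vs ! j $ i"]
      obtain T where T: "T \<subseteq> S" "\<And>a. \<not> (\<forall>i\<in>S. x a i \<noteq> 0 \<and> (x a i > 0 \<longleftrightarrow> i \<in> T))"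
        by (auto simp: x_def)
      from S(2) T(1) obtain a where "a \<in> P" "pos a \<inter> S = T" unfolding shatters_def by blast
      then have "\<forall>i\<in>S. x a i \<noteq> 0 \<and> (x a i > 0 \<longleftrightarrow> i \<in> T)"
        using S(1) by (auto simp: P_def pos_def)
      with T(2) show False by blast
    qed
  qed
  finally show ?thesis .
qed

section \<open>The moment curve\<close>

text \<open>The monomials of degree less than \<open>d\<close>, evaluated at the nodes
  \<open>0, ..., n - 1\<close>. Membership in the span then only requires a polynomial of small
  degree.\<close>

definition moment_vecs :: "nat \<Rightarrow> nat \<Rightarrow> real vec list" where
  "moment_vecs n d = map (\<lambda>j. vec n (\<lambda>i. real i ^ j)) [0..<d]"

lemma poly_in_subspace_gen_moment:
  assumes "degree p < d"
  shows "vec n (\<lambda>i. poly p (real i)) \<in> subspace_gen n (moment_vecs n d)"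
proof -
  have carr: "set (moment_vecs n d) \<subseteq> carrier_vec n" by (auto simp: moment_vecs_def)
  have "poly p y = (\<Sum>j<d. coeff p j * y ^ j)" for y
    unfolding poly_altdef using assms by (intro sum.mono_neutral_left) (auto intro: coeff_eq_0)
  then have "vec n (\<lambda>i. poly p (real i)) =
      vec n (\<lambda>i. \<Sum>j<length (moment_vecs n d). coeff p j * moment_vecs n d ! j $ i)"
    by (intro eq_vecI) (auto simp: moment_vecs_def intro!: sum.cong)
  then show ?thesis unfolding subspace_gen_iff[OF carr] by blast
qed

text \<open>The half-integer roots place the sign changes of the polynomial on the integers exactly
  between k and k + 1 for \<open>k \<in> K\<close>.\<close>

definition alternating_poly :: "real \<Rightarrow> nat set \<Rightarrow> real poly" where
  "alternating_poly s K = Polynomial.smult s (\<Prod>k\<in>K. [:- (real k + 1 / 2), 1:])"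

lemma poly_alternating_poly:
  "poly (alternating_poly s K) y = s * (\<Prod>k\<in>K. y - (real k + 1 / 2))"
proof -
  have "poly [:- c, 1:] y = y - c" for c by simp
  then show ?thesis by (simp only: alternating_poly_def poly_smult poly_prod)
qed

lemma degree_alternating_poly:
  assumes "finite K"
  shows "degree (alternating_poly s K) \<le> card K"
proof -
  have "degree (\<Prod>k\<in>K. [:- (real k + 1 / 2), 1:]) \<le> (\<Sum>k\<in>K. 1)"
    using degree_prod_sum_le[OF assms, of "\<lambda>k. [:- (real k + 1 / 2), 1:]"] by (simp add: o_def)
  then show ?thesis
    unfolding alternating_poly_def by (intro order_trans[OF degree_smult_le]) simp
qed

lemma integer_half_integer_neq: "real i \<noteq> real k + 1 / 2"
proof
  assume "real i = real k + 1 / 2"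
  then have "real (2 * i) = real (2 * k + 1)" by simp
  then have "2 * i = 2 * k + 1" by (simp only: of_nat_eq_iff)
  then show False by presburger
qed

lemma alternating_poly_nonzero:
  assumes "finite K" "s \<noteq> 0"
  shows "poly (alternating_poly s K) (real i) \<noteq> 0"
  using assms integer_half_integer_neq[of i] by (auto simp: poly_alternating_poly)

lemma alternating_poly_sign_change:
  assumes K: "finite K" and s: "s \<noteq> 0"
  shows "poly (alternating_poly s K) (real i) * poly (alternating_poly s K) (real (Suc i)) < 0
    \<longleftrightarrow> i \<in> K"
proof -
  \<comment> \<open>The contribution of one root to the product of the two values. It is negative
    only if the root lies between the nodes \<open>i\<close> and \<open>i + 1\<close>, that is, for
    \<open>k = i\<close>.\<close>
  define g where "g = (\<lambda>k. (real i - (real k + 1 / 2)) * (real (Suc i) - (real k + 1 / 2)))"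
  have g: "g k > 0" if "k \<noteq> i" for k
  proof (cases "k < i")
    case True
    then have "real k + 1 \<le> real i" by linarith
    then show ?thesis unfolding g_def by (intro mult_pos_pos) auto
  next
    case False
    with that have "real i + 1 \<le> real k" by linarith
    then show ?thesis unfolding g_def by (intro mult_neg_neg) auto
  qed
  have gi: "g i < 0" by (simp add: g_def)
  have "poly (alternating_poly s K) (real i) * poly (alternating_poly s K) (real (Suc i))
      = s\<^sup>2 * prod g K"
    by (simp add: poly_alternating_poly g_def prod.distrib power2_eq_square)
  moreover have "s\<^sup>2 > 0" using s by simp
  moreover have "prod g K < 0 \<longleftrightarrow> i \<in> K"
  proof (cases "i \<in> K")
    case True
    have "prod g (K - {i}) > 0" using g by (intro prod_pos) auto
    then show ?thesis using True gi K by (simp add: prod.remove mult_neg_pos)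
  next
    case False
    then have "prod g K > 0" using g by (intro prod_pos) metis
    with False show ?thesis by simp
  qed
  ultimately show ?thesis by (simp add: mult_less_0_iff)
qed

text \<open>Each pair \<open>(s, K)\<close> of a leading sign and a set of at most \<open>k\<close>
  gaps yields a polynomial of degree at most \<open>k\<close>. Its sign vector determines the pair,
  so distinct pairs hit distinct orthants.\<close>

lemma num_orthants_moment_ge:
  "2 * (\<Sum>i = 0..k. m choose i)
    \<le> num_orthants (Suc m) (subspace_gen (Suc m) (moment_vecs (Suc m) (Suc k)))"
proof -
  define \<K> where "\<K> = {K. K \<subseteq> {..<m} \<and> card K \<le> k}"
  define h where "h = (\<lambda>(s, K). vec (Suc m) (\<lambda>i. sgn (poly (alternating_poly s K) (real i))))"
  let ?D = "{-1, 1} \<times> \<K>"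
  have fin: "finite K" if "K \<in> \<K>" for K using that finite_subset by (auto simp: \<K>_def)
  have "inj_on h ?D"
  proof (rule inj_onI, clarify)
    fix s s' :: real and K K'
    assume s: "s \<in> {-1, 1}" "s' \<in> {-1, 1}" and K: "K \<in> \<K>" "K' \<in> \<K>" and eq: "h (s, K) = h (s', K')"
    let ?p = "alternating_poly s K" and ?p' = "alternating_poly s' K'"
    have nz: "s \<noteq> 0" "s' \<noteq> 0" using s by auto
    have sg: "sgn (poly ?p (real i)) = sgn (poly ?p' (real i))" if "i \<le> m" for i
      using arg_cong[OF eq, of "\<lambda>v. v $ i"] that by (simp add: h_def)
    \<comment> \<open>\<open>K\<close> is recovered as the set of places where consecutive signs
      differ.\<close>
    have "i \<in> K \<longleftrightarrow> i \<in> K'" if "i < m" for i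
    proof -
      have "sgn (poly ?p (real i) * poly ?p (real (Suc i)))
          = sgn (poly ?p' (real i) * poly ?p' (real (Suc i)))"
        using that by (simp only: sgn_mult sg Suc_le_eq less_imp_le)
      then have "poly ?p (real i) * poly ?p (real (Suc i)) < 0
          \<longleftrightarrow> poly ?p' (real i) * poly ?p' (real (Suc i)) < 0"
        by (metis sgn_less)
      then show ?thesis
        unfolding alternating_poly_sign_change[OF fin[OF K(1)] nz(1)]
          alternating_poly_sign_change[OF fin[OF K(2)] nz(2)] .
    qed
    then have KK: "K = K'" using K by (auto simp: \<K>_def)
    \<comment> \<open>With \<open>K = K'\<close> known, both values at the node \<open>m\<close>
      contain this same nonzero factor; cancelling its sign leaves the signs of \<open>s\<close> and
      \<open>s'\<close>.\<close>
    have "(\<Prod>k\<in>K. real m - (real k + 1 / 2)) \<noteq> 0"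
      using fin[OF K(1)] integer_half_integer_neq[of m] by simp
    moreover have "sgn s * sgn (\<Prod>k\<in>K. real m - (real k + 1 / 2))
        = sgn s' * sgn (\<Prod>k\<in>K. real m - (real k + 1 / 2))"
      using sg[of m] KK by (simp add: poly_alternating_poly sgn_mult)
    ultimately have "sgn s = sgn s'" by (simp add: sgn_zero_iff)
    then have "s = s'" using s by auto
    with KK show "s = s' \<and> K = K'" by simp
  qed
  then have "card (h ` ?D) = 2 * card \<K>" by (simp add: card_image card_cartesian_product)
  moreover have "card \<K> = (\<Sum>i = 0..k. m choose i)"
    unfolding \<K>_def by (rule card_subsets_le)
  moreover have "card (h ` ?D) \<le> num_orthants (Suc m) (subspace_gen (Suc m) (moment_vecs (Suc m) (Suc k)))"
    unfolding num_orthants_def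
  proof (rule card_mono)
    show "finite {e \<in> sign_vectors (Suc m).
        subspace_gen (Suc m) (moment_vecs (Suc m) (Suc k)) \<inter> orthant_interior (Suc m) e \<noteq> {}}"
      using finite_sign_vectors by simp
    show "h ` ?D \<subseteq> {e \<in> sign_vectors (Suc m).
        subspace_gen (Suc m) (moment_vecs (Suc m) (Suc k)) \<inter> orthant_interior (Suc m) e \<noteq> {}}"
    proof (rule image_subsetI, clarify)
      fix s :: real and K assume s: "s \<in> {-1, 1}" and K: "K \<in> \<K>"
      let ?p = "alternating_poly s K"
      have "poly ?p (real i) \<noteq> 0" for i
        using alternating_poly_nonzero[OF fin[OF K]] s by auto
      then have "h (s, K) \<in> sign_vectors (Suc m)" by (auto simp: h_def sign_vectors_def sgn_if)
      moreover have "degree ?p < Suc k"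
        using degree_alternating_poly[OF fin[OF K], of s] K by (simp add: \<K>_def)
      from poly_in_subspace_gen_moment[OF this]
      have "vec (Suc m) (\<lambda>i. poly ?p (real i)) \<in>
          subspace_gen (Suc m) (moment_vecs (Suc m) (Suc k)) \<inter> orthant_interior (Suc m) (h (s, K))"
        by (auto simp: h_def orthant_interior_def)
      ultimately show "h (s, K) \<in> sign_vectors (Suc m) \<and>
          subspace_gen (Suc m) (moment_vecs (Suc m) (Suc k)) \<inter> orthant_interior (Suc m) (h (s, K)) \<noteq> {}"
        by blast
    qed
  qed
  ultimately show ?thesis by simp
qed

section \<open>The exact maximum and its consequences\<close>

lemma max_orthants_Suc: "max_orthants (Suc m) (Suc k) = 2 * (\<Sum>i = 0..k. m choose i)"
proof -
  let ?N = "{num_orthants (Suc m) (subspace_gen (Suc m) vs) | vs.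
    length vs = Suc k \<and> set vs \<subseteq> carrier_vec (Suc m)}"
  have "length (moment_vecs (Suc m) (Suc k)) = Suc k"
    "set (moment_vecs (Suc m) (Suc k)) \<subseteq> carrier_vec (Suc m)"
    by (auto simp: moment_vecs_def)
  then have "num_orthants (Suc m) (subspace_gen (Suc m) (moment_vecs (Suc m) (Suc k))) \<in> ?N"
    by blast
  from Max_ge[OF finite_num_orthants this]
  have "2 * (\<Sum>i = 0..k. m choose i) \<le> Max ?N"
    using num_orthants_moment_ge order_trans by blast
  moreover have "Max ?N \<le> 2 * (\<Sum>i = 0..k. m choose i)"
    using num_orthants_le by (subst Max_le_iff[OF finite_num_orthants nonempty_num_orthants]) auto
  ultimately show ?thesis unfolding max_orthants_def by simp
qed

text \<open>Pascal's rule summed along a row; doubled, it becomes the recurrence for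
  \<open>max_orthants\<close>.\<close>

lemma sum_choose_Suc:
  "(\<Sum>i = 0..Suc k. Suc m choose i) = (\<Sum>i = 0..k. m choose i) + (\<Sum>i = 0..Suc k. m choose i)"
  by (induction k) auto

lemma sum_choose_ge:
  assumes "m \<le> k"
  shows "(\<Sum>i = 0..k. m choose i) = 2 ^ m"
proof -
  have "(\<Sum>i = 0..k. m choose i) = (\<Sum>i\<le>m. m choose i)"
    using assms by (intro sum.mono_neutral_right) auto
  then show ?thesis by (simp add: choose_row_sum)
qed

theorem theorem5p1:
  shows "(\<forall>n::nat. n \<ge> 1 \<longrightarrow> max_orthants n 1 = 2) \<and>
    (\<forall>(n::nat) d::nat. n \<ge> 1 \<longrightarrow> d \<ge> n \<longrightarrow> max_orthants n d = 2 ^ n) \<and>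
    (\<forall>(n::nat) d::nat. n \<ge> 1 \<longrightarrow> d \<ge> 1 \<longrightarrow>
       max_orthants n d = 2 * (\<Sum>i = 0..d - 1. (n - 1) choose i)) \<and>
    (\<forall>(n::nat) d::nat. n \<ge> 2 \<longrightarrow> d \<ge> 2 \<longrightarrow>
       max_orthants n d = max_orthants (n - 1) (d - 1) + max_orthants (n - 1) d)"
proof (intro conjI allI impI)
  have formula: "max_orthants n d = 2 * (\<Sum>i = 0..d - 1. (n - 1) choose i)"
    if "n \<ge> 1" "d \<ge> 1" for n d
    using max_orthants_Suc[of "n - 1" "d - 1"] that by simp
  show "max_orthants n 1 = 2" if "n \<ge> 1" for n
    using formula[OF that, of 1] by simp
  show "max_orthants n d = 2 * (\<Sum>i = 0..d - 1. (n - 1) choose i)" if "n \<ge> 1" "d \<ge> 1" for n d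
    using formula[OF that] .
  show "max_orthants n d = 2 ^ n" if "n \<ge> 1" "d \<ge> n" for n d
  proof -
    \<comment> \<open>From \<open>d \<ge> n\<close> the sum reaches index \<open>n - 1\<close> and
      covers the whole row of binomial coefficients.\<close>
    have "max_orthants n d = 2 * 2 ^ (n - 1)"
      using that by (subst formula) (auto simp: sum_choose_ge)
    then show ?thesis using that(1) by (cases n) auto
  qed
  show "max_orthants n d = max_orthants (n - 1) (d - 1) + max_orthants (n - 1) d"
    if "n \<ge> 2" "d \<ge> 2" for n d
  proof -
    \<comment> \<open>Two successors are split off so that \<open>n - 1\<close> and
      \<open>d - 1\<close> are still positive and \<open>max_orthants_Suc\<close> evaluates all
      three terms.\<close>
    obtain m where m: "n = Suc (Suc m)" using \<open>n \<ge> 2\<close> by (metis Suc_le_D numeral_2_eq_2 Suc_le_mono)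
    obtain k where k: "d = Suc (Suc k)" using \<open>d \<ge> 2\<close> by (metis Suc_le_D numeral_2_eq_2 Suc_le_mono)
    show ?thesis unfolding m k by (simp only: diff_Suc_1 max_orthants_Suc sum_choose_Suc add_mult_distrib2)
  qed
qed

end
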